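(* Let $\sigma=(\sigma_1,\dots,\sigma_l)$ be a node of the PE-B\&B tree, and let $\mathcal{M}_{\sigma}=(M_1,\dots,M_l)$ be an optimal sequence of magazine configurations covering $\sigma$, computed according to the KTNS policy. Suppose that there exists an index $p\in\{2,\dots,l\}$ such that $T_{\sigma_{p-1}}\subseteq M_p$, $T_{\sigma_{p-1}}\subseteq\bigcup_{k=p}^{l}T_{\sigma_k}$, and $\sigma_{p-1}>\sigma_p$. Then node $\sigma$ is dominated by $\sigma'=(\sigma_1,\dots,\sigma_{p-2},\sigma_p,\sigma_{p-1},\sigma_{p+1},\dots,\sigma_l)$.
   Context: Job Sequencing and Tool Switching Problem (SSP). We are given tools $T=\{1,\dots,m\}$, jobs $J=\{1,\dots,n\}$ (so jobs are compared as integers), a magazine capacity $c<m$, and for each job $j\in J$ a required toolset $T_j\subseteq T$ with $|T_j|\le c$. Every tool is required by some job: $T=\bigcup_{j\in J}T_j$. A (partial) sequence $\sigma=(\sigma_1,\dots,\sigma_l)$ consists of pairwise distinct jobs; $J_\sigma=\{\sigma_1,\dots,\sigma_l\}$ and $\overline{J}_\sigma=J\setminus J_\sigma$. A magazine configuration is a set $M\subseteq T$ with $|M|=c$. A sequence of magazine configurations $\mathcal{M}=(M_1,\dots,M_l)$ covers $\sigma$ if $T_{\sigma_i}\subseteq M_i$ for $i=1,\dots,l$. Its number of tool switches is $z(\mathcal{M})=\sum_{i=2}^{l}|M_i\setminus M_{i-1}|$ (so the initial loading is free). Let $z(\sigma)$ be the minimum of $z(\mathcal{M})$ over all $\mathcal{M}$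 covering $\sigma$; a covering $\mathcal{M}$ attaining it is optimal. KTNS (Keep Tool Needed Soonest) policy. For a sequence $\sigma=(\sigma_1,\dots,\sigma_l)$, let the next use of tool $t$ from position $i$ be $\min\{k\ge i : t\in T_{\sigma_k}\}$, or $+\infty$ if there is no such $k$. KTNS takes $M_1$ to consist of $c$ tools with the smallest next use from position $1$ (in particular $T_{\sigma_1}\subseteq M_1$). Going from position $i$ to $i+1$, it inserts exactly the tools of $T_{\sigma_{i+1}}\setminus M_i$ and removes the same number of tools from $M_i\setminus T_{\sigma_{i+1}}$, choosing those with the largest next use from position $i+1$; ties are broken by a fixed rule. The resulting sequence of configurations is optimal for $\sigma$ (a classical fact). PE-B\&B tree. The root is the empty sequence; the children of a node $\sigma$ are the sequences obtained by appending one job of $\overline{J}_\sigma$ at the end of $\sigma$ (one child per job). Thus the nodes are all sequences of distinct jobs, and the leaves are the permutations of $J$. A completion of a node $\sigma$ is any permutation of $J$ having $\sigma$ as a prefix. The optimal value of the subproblem associated with $\sigma$ is the minimum of $z(\overline{\sigma})$ over all completions $\overline{\sigma}$ of $\sigma$. Node $\sigma$ is dominated by node $\sigma'$ if the optimal value of the subproblem associated with $\sigma'$ is not larger than that of the subproblem associated with $\sigma$. *)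

theory Defs
  imports "HOL-Library.Extended_Nat" "HOL-Library.Sublist"
    "HOL-Combinatorics.Multiset_Permutations"
begin

text \<open>
  Tools are \<open>{1..m}\<close>, jobs are \<open>{1..n}\<close>, \<open>c\<close> is the magazine capacity and \<open>T j\<close> is the toolset
  of job \<open>j\<close>. Sequences of jobs and of magazine configurations are lists; positions in them
  are counted from 0.
\<close>

definition ssp_instance :: "nat \<Rightarrow> nat \<Rightarrow> nat \<Rightarrow> (nat \<Rightarrow> nat set) \<Rightarrow> bool" where
  "ssp_instance m n c T \<longleftrightarrow>
     c < m \<and> (\<forall>j\<in>{1..n}. T j \<subseteq> {1..m} \<and> card (T j) \<le> c) \<and> {1..m} = (\<Union>j\<in>{1..n}. T j)"

definition magazine_config :: "nat \<Rightarrow> nat \<Rightarrow> nat set \<Rightarrow> bool" where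
  "magazine_config m c M \<longleftrightarrow> M \<subseteq> {1..m} \<and> card M = c"

definition covers :: "nat \<Rightarrow> nat \<Rightarrow> (nat \<Rightarrow> nat set) \<Rightarrow> nat list \<Rightarrow> nat set list \<Rightarrow> bool" where
  "covers m c T \<sigma> Ms \<longleftrightarrow>
     length Ms = length \<sigma> \<and>
     (\<forall>i<length \<sigma>. magazine_config m c (Ms ! i) \<and> T (\<sigma> ! i) \<subseteq> Ms ! i)"

definition switches :: "nat set list \<Rightarrow> nat" where
  "switches Ms = (\<Sum>i = 1..<length Ms. card (Ms ! i - Ms ! (i - 1)))"

definition min_switches :: "nat \<Rightarrow> nat \<Rightarrow> (nat \<Rightarrow> nat set) \<Rightarrow> nat list \<Rightarrow> nat" where
  "min_switches m c T \<sigma> = (LEAST k. \<exists>Ms. covers m c T \<sigma> Ms \<and> k = switches Ms)"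

definition optimal_covering ::
  "nat \<Rightarrow> nat \<Rightarrow> (nat \<Rightarrow> nat set) \<Rightarrow> nat list \<Rightarrow> nat set list \<Rightarrow> bool" where
  "optimal_covering m c T \<sigma> Ms \<longleftrightarrow> covers m c T \<sigma> Ms \<and> switches Ms = min_switches m c T \<sigma>"

text \<open>In \<^typ>\<open>enat\<close> the infimum of the empty set is \<open>\<infinity>\<close>.\<close>

definition next_use :: "(nat \<Rightarrow> nat set) \<Rightarrow> nat list \<Rightarrow> nat \<Rightarrow> nat \<Rightarrow> enat" where
  "next_use T \<sigma> i t = (INF k\<in>{k. i \<le> k \<and> k < length \<sigma> \<and> t \<in> T (\<sigma> ! k)}. enat k)"

text \<open>
  The policy is a relation between job sequences and configuration sequences: any choice among
  tools with equal next use is allowed, so the outcome of every tie-breaking rule satisfies it.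
  Here \<open>R\<close> is the set of tools removed on the way from position \<open>i\<close> to position \<open>Suc i\<close>.
\<close>

definition ktns :: "nat \<Rightarrow> nat \<Rightarrow> (nat \<Rightarrow> nat set) \<Rightarrow> nat list \<Rightarrow> nat set list \<Rightarrow> bool" where
  "ktns m c T \<sigma> Ms \<longleftrightarrow>
     length Ms = length \<sigma> \<and>
     (\<sigma> \<noteq> [] \<longrightarrow>
        magazine_config m c (Ms ! 0) \<and>
        (\<forall>t\<in>Ms ! 0. \<forall>u\<in>{1..m} - Ms ! 0. next_use T \<sigma> 0 t \<le> next_use T \<sigma> 0 u)) \<and>
     (\<forall>i. Suc i < length \<sigma> \<longrightarrow>
        (\<exists>R. R \<subseteq> Ms ! i - T (\<sigma> ! Suc i) \<and>
             card R = card (T (\<sigma> ! Suc i) - Ms ! i) \<and>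
             (\<forall>r\<in>R. \<forall>t\<in>(Ms ! i - T (\<sigma> ! Suc i)) - R.
                next_use T \<sigma> (Suc i) t \<le> next_use T \<sigma> (Suc i) r) \<and>
             Ms ! Suc i = (Ms ! i - R) \<union> (T (\<sigma> ! Suc i) - Ms ! i)))"

inductive tree_node :: "nat \<Rightarrow> nat list \<Rightarrow> bool" for n :: nat where
  root: "tree_node n []"
| child: "tree_node n \<sigma> \<Longrightarrow> j \<in> {1..n} - set \<sigma> \<Longrightarrow> tree_node n (\<sigma> @ [j])"

lemma tree_node_iff: "tree_node n \<sigma> \<longleftrightarrow> distinct \<sigma> \<and> set \<sigma> \<subseteq> {1..n}"
proof
  show "tree_node n \<sigma> \<Longrightarrow> distinct \<sigma> \<and> set \<sigma> \<subseteq> {1..n}"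
    by (induction rule: tree_node.induct) auto
  show "distinct \<sigma> \<and> set \<sigma> \<subseteq> {1..n} \<Longrightarrow> tree_node n \<sigma>"
    by (induction \<sigma> rule: rev_induct) (auto intro: tree_node.intros)
qed

definition completions :: "nat \<Rightarrow> nat list \<Rightarrow> nat list set" where
  "completions n \<sigma> = {\<tau> \<in> permutations_of_set {1..n}. prefix \<sigma> \<tau>}"

definition subproblem_value ::
  "nat \<Rightarrow> nat \<Rightarrow> nat \<Rightarrow> (nat \<Rightarrow> nat set) \<Rightarrow> nat list \<Rightarrow> nat" where
  "subproblem_value m n c T \<sigma> = (LEAST k. \<exists>\<tau>\<in>completions n \<sigma>. k = min_switches m c T \<tau>)"

definition dominated_by ::
  "nat \<Rightarrow> nat \<Rightarrow> nat \<Rightarrow> (nat \<Rightarrow> nat set) \<Rightarrow> nat list \<Rightarrow> nat list \<Rightarrow> bool" where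
  "dominated_by m n c T \<sigma> \<sigma>' \<longleftrightarrow>
     tree_node n \<sigma> \<and> tree_node n \<sigma>' \<and>
     subproblem_value m n c T \<sigma>' \<le> subproblem_value m n c T \<sigma>"

end

theory Submission imports Defs begin

text \<open>
  The swapped sequence is cheap as soon as the original one has a good covering. Write \<open>a\<close> and
  \<open>b\<close> for the jobs at positions \<open>p - 1\<close> and \<open>p\<close>. If a completion \<open>\<tau>\<close> of \<open>\<sigma>\<close> has an optimal
  covering whose configuration \<open>N\<close> at position \<open>p\<close> contains \<open>T a\<close> (besides \<open>T b\<close>), then \<open>N\<close> can
  serve both jobs, in either order. Using \<open>N\<close> at both positions covers \<open>\<tau>\<close> with \<open>a\<close> and \<open>b\<close>
  exchanged, and by the triangle inequality for \<open>card (Y - X)\<close> this costs no more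
  (\<open>covering_of_swap\<close>).

  So the point is to find such an optimal covering for every completion \<open>\<tau> = \<sigma> @ \<rho>\<close>. The given
  configurations were computed by KTNS from \<open>\<sigma>\<close> alone, without knowledge of \<open>\<rho>\<close>, and they are
  in general not the beginning of an optimal covering of \<open>\<tau>\<close>: tools that are not used again in
  \<open>\<sigma>\<close> look alike to KTNS, but may differ for \<open>\<rho>\<close>. The tools that are used again in \<open>\<sigma>\<close>,
  however, are used before all the others whatever \<open>\<rho>\<close> is, and among them the order of next uses
  does not depend on \<open>\<rho>\<close>. Hence every covering of \<open>\<tau>\<close> can be changed, at no cost, into one that at
  each position \<open>i\<close> of \<open>\<sigma>\<close> agrees with KTNS on the tools required from position \<open>i\<close> of \<open>\<sigma>\<close>
  onwards (\<open>follow_greedy\<close>). By hypothesis \<open>T a\<close> consists of such tools for \<open>i = p\<close>, and KTNS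
  holds them at position \<open>p\<close>.

  The change is made one tool at a time (\<open>replace_tool_in_first\<close>). Bringing a tool \<open>t\<close> of the
  previous configuration back in place of a tool \<open>u\<close> is harmless for two possible reasons:
  either \<open>u\<close> had just been inserted, and the switch saved pays for a later insertion of \<open>u\<close>; or
  \<open>t\<close> is used no later than \<open>u\<close>, and having \<open>t\<close> is at least as good as having \<open>u\<close>
  (\<open>exchange_initial_tool\<close>).

  The free initial loading is treated as a switch from a magazine that holds all tools. The
  first configuration of KTNS then obeys the same rule as the later ones.
\<close>

section \<open>Coverings and their cost from a given magazine content\<close>

fun cost_from :: "'a set \<Rightarrow> 'a set list \<Rightarrow> nat" where
  "cost_from A [] = 0"
| "cost_from A (N # Ns) = card (N - A) + cost_from N Ns"

lemma cost_from_append: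
  "cost_from A (Ns @ Ns') = cost_from A Ns + cost_from (last (A # Ns)) Ns'"
  by (induction Ns arbitrary: A) auto

lemma switches_Cons: "switches (N # Ns) = cost_from N Ns"
proof (induction Ns arbitrary: N)
  case Nil
  show ?case by (simp add: switches_def)
next
  case (Cons N' Ns)
  have "switches (N # N' # Ns) = card (N' - N) + switches (N' # Ns)"
    unfolding switches_def
    by (simp add: sum.atLeast_Suc_lessThan sum.shift_bounds_Suc_ivl del: sum.op_ivl_Suc)
  with Cons.IH show ?case by simp
qed

lemma covers_Nil [simp]: "covers m c T [] Ns \<longleftrightarrow> Ns = []"
  by (auto simp: covers_def)

lemma covers_Cons [simp]:
  "covers m c T (j # \<tau>) (N # Ns) \<longleftrightarrow> magazine_config m c N \<and> T j \<subseteq> N \<and> covers m c T \<tau> Ns"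
  by (auto simp add: covers_def All_less_Suc2)

lemma covers_ConsE:
  assumes "covers m c T (j # \<tau>) Ns"
  obtains N Ns' where "Ns = N # Ns'" "magazine_config m c N" "T j \<subseteq> N" "covers m c T \<tau> Ns'"
proof -
  from assms have "length Ns = Suc (length \<tau>)" by (simp add: covers_def)
  then obtain N Ns' where "Ns = N # Ns'" by (cases Ns) auto
  with assms that show thesis by auto
qed

lemma covers_append:
  assumes "length Ns = length \<tau>"
  shows "covers m c T (\<tau> @ \<tau>') (Ns @ Ns') \<longleftrightarrow> covers m c T \<tau> Ns \<and> covers m c T \<tau>' Ns'"
  using assms by (induction Ns \<tau> rule: list_induct2) auto

lemma magazine_config_finite: "magazine_config m c N \<Longrightarrow> finite N"
  by (auto simp: magazine_config_def intro: finite_subset)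

lemma cost_from_all_tools:
  assumes "covers m c T \<tau> Ns"
  shows "cost_from {1..m} Ns = switches Ns"
proof (cases \<tau>)
  case Nil
  with assms show ?thesis by (simp add: switches_def)
next
  case (Cons j \<tau>')
  with assms obtain N Ns' where "Ns = N # Ns'" "magazine_config m c N"
    by (auto elim: covers_ConsE)
  then have "N - {1..m} = {}"
    by (auto simp: magazine_config_def)
  with \<open>Ns = N # Ns'\<close> show ?thesis by (simp only: cost_from.simps switches_Cons card.empty)
qed

lemma cost_from_triangle:
  assumes "covers m c T \<tau> Ns" and "finite B"
  shows "cost_from A Ns \<le> card (B - A) + cost_from B Ns"
proof (cases \<tau>)
  case Nil
  with assms show ?thesis by simp
next
  case (Cons j \<tau>')
  with assms obtain N Ns' where Ns: "Ns = N # Ns'" and N: "magazine_config m c N"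
    by (auto elim: covers_ConsE)
  have "card (N - A) \<le> card ((B - A) \<union> (N - B))"
    using assms(2) magazine_config_finite[OF N] by (intro card_mono) auto
  also have "\<dots> \<le> card (B - A) + card (N - B)"
    by (rule card_Un_le)
  finally show ?thesis by (simp add: Ns)
qed

section \<open>Exchanging single tools\<close>

definition no_later :: "('j \<Rightarrow> 'a set) \<Rightarrow> 'j list \<Rightarrow> 'a \<Rightarrow> 'a \<Rightarrow> bool" where
  "no_later T \<tau> t u \<longleftrightarrow> (\<forall>k<length \<tau>. u \<in> T (\<tau> ! k) \<longrightarrow> (\<exists>k'\<le>k. t \<in> T (\<tau> ! k')))"

lemma no_later_Cons:
  "no_later T (j # \<tau>) t u \<longleftrightarrow> t \<in> T j \<or> u \<notin> T j \<and> no_later T \<tau> t u"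
proof -
  have "(\<exists>k'\<le>Suc k. P k') \<longleftrightarrow> P 0 \<or> (\<exists>k'\<le>k. P (Suc k'))" for P and k :: nat
    by (metis Suc_le_mono le0 not0_implies_Suc)
  then show ?thesis
    by (auto simp: no_later_def All_less_Suc2)
qed

lemma no_later_unused: "u \<notin> \<Union> (T ` set \<tau>) \<Longrightarrow> no_later T \<tau> t u"
  by (auto simp: no_later_def)

lemma no_later_used:
  assumes "no_later T \<tau> t u" and "u \<in> \<Union> (T ` set \<tau>)"
  shows "t \<in> \<Union> (T ` set \<tau>)"
proof -
  from assms(2) obtain k where k: "k < length \<tau>" "u \<in> T (\<tau> ! k)"
    by (auto simp: in_set_conv_nth)
  with assms(1) obtain k' where "k' \<le> k" "t \<in> T (\<tau> ! k')"
    by (auto simp: no_later_def)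
  with k show ?thesis by (auto intro!: bexI[of _ "\<tau> ! k'"])
qed

text \<open>A tool used in \<open>\<sigma>\<close> precedes in \<open>\<sigma> @ \<rho>\<close> all uses in \<open>\<rho>\<close>, so the order cannot change.\<close>

lemma no_later_append:
  assumes "no_later T \<sigma> t u" and "t \<in> \<Union> (T ` set \<sigma>)"
  shows "no_later T (\<sigma> @ \<rho>) t u"
  using assms by (induction \<sigma>) (auto simp: no_later_Cons)

text \<open>
  The covering that starts with \<open>t\<close> imitates the one that starts with \<open>u\<close>, holding \<open>t\<close> instead of
  \<open>u\<close> until the first position where the latter drops \<open>u\<close> or acquires \<open>t\<close>; there it joins the
  latter, at the same or a smaller cost. Until then \<open>u\<close> is never missed: \<open>t\<close> is required no later
  than \<open>u\<close>, and a covering that holds only \<open>u\<close> must acquire \<open>t\<close> when \<open>t\<close> is required.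
\<close>

lemma exchange_initial_tool:
  assumes "covers m c T \<tau> Ns" and "no_later T \<tau> t u"
    and "t \<notin> X" "u \<notin> X" "t \<in> {1..m}"
  shows "\<exists>Ns'. covers m c T \<tau> Ns' \<and> cost_from (insert t X) Ns' \<le> cost_from (insert u X) Ns"
  using assms
proof (induction \<tau> arbitrary: Ns X)
  case Nil
  then show ?case by simp
next
  case (Cons j \<tau>)
  from Cons.prems(1) obtain N Ns0 where Ns: "Ns = N # Ns0"
    and N: "magazine_config m c N" "T j \<subseteq> N" and Ns0: "covers m c T \<tau> Ns0"
    by (rule covers_ConsE)
  have fin: "finite N" using N(1) by (rule magazine_config_finite)
  show ?case
  proof (cases "u \<in> N \<and> t \<notin> N")
    case False
    have "card (N - insert t X) \<le> card (N - insert u X)"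
    proof (cases "u \<in> N")
      case True
      with False have "t \<in> N" by simp
      have "card (N - insert t X) = card (N - X) - 1"
        using \<open>t \<in> N\<close> Cons.prems(3) Diff_insert[of N t X] by simp
      moreover have "card (N - insert u X) = card (N - X) - 1"
        using \<open>u \<in> N\<close> Cons.prems(4) Diff_insert[of N u X] by simp
      ultimately show ?thesis by simp
    next
      case False
      then show ?thesis using fin by (intro card_mono) auto
    qed
    with Cons.prems(1) Ns show ?thesis by (intro exI[of _ Ns]) simp
  next
    case True
    define Y where "Y = N - {u}"
    have Y: "N = insert u Y" "u \<notin> Y" "t \<notin> Y" "finite Y"
      using True fin by (auto simp: Y_def)
    have "u \<notin> T j" "no_later T \<tau> t u"
      using Cons.prems(2) True N(2) by (auto simp: no_later_Cons)
    then obtain Ns' where Ns': "covers m c T \<tau> Ns'"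
      "cost_from (insert t Y) Ns' \<le> cost_from N Ns0"
      using Cons.IH[OF Ns0 _ Y(3,2) Cons.prems(5)] Y(1) by auto
    have "magazine_config m c (insert t Y)"
      using N(1) Y Cons.prems(5) by (auto simp: magazine_config_def)
    moreover have "T j \<subseteq> insert t Y"
      using N(2) Y(1) \<open>u \<notin> T j\<close> by auto
    moreover have "insert t Y - insert t X = N - insert u X"
      using Y by auto
    ultimately show ?thesis
      using Ns Ns' by (intro exI[of _ "insert t Y # Ns'"]) simp
  qed
qed

lemma replace_tool_in_first:
  assumes "covers m c T (j # \<tau>) (N # Ns)"
    and "u \<in> N" "u \<notin> T j" "t \<in> B" "t \<notin> N" "t \<in> {1..m}"
    and "u \<notin> B \<or> no_later T \<tau> t u"
  shows "\<exists>Ns'. covers m c T (j # \<tau>) (insert t (N - {u}) # Ns') \<and>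
    cost_from B (insert t (N - {u}) # Ns') \<le> cost_from B (N # Ns)"
proof -
  define N' where "N' = insert t (N - {u})"
  have N: "magazine_config m c N" "T j \<subseteq> N" and Ns: "covers m c T \<tau> Ns"
    using assms(1) by auto
  have fin: "finite N" using N(1) by (rule magazine_config_finite)
  have "card N' = card N"
    using fin assms(2,5) card_Suc_Diff1[of N u] by (simp add: N'_def)
  then have N': "magazine_config m c N'" "T j \<subseteq> N'"
    using N assms(3,6) by (auto simp: magazine_config_def N'_def)
  have diff: "N' - B = (N - B) - {u}"
    using assms(4) by (auto simp: N'_def)
  have "\<exists>Ns'. covers m c T \<tau> Ns' \<and> card (N' - B) + cost_from N' Ns' \<le> card (N - B) + cost_from N Ns"
  proof (cases "u \<in> B")
    case True
    with assms(7) have "no_later T \<tau> t u" by simp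
    from exchange_initial_tool[OF Ns this, of "N - {u}"] assms
    obtain Ns' where "covers m c T \<tau> Ns'" "cost_from N' Ns' \<le> cost_from N Ns"
      by (auto simp: N'_def insert_absorb)
    moreover have "N' - B = N - B"
      using diff True by auto
    ultimately show ?thesis by auto
  next
    case False
    have "card (N - B) = Suc (card (N' - B))"
      using diff False assms(2) fin card_Suc_Diff1[of "N - B" u] by simp
    moreover have "cost_from N' Ns \<le> card (N - N') + cost_from N Ns"
      using Ns fin by (rule cost_from_triangle)
    moreover have "N - N' = {u}"
      using assms(2,5) by (auto simp: N'_def)
    ultimately show ?thesis using Ns by (intro exI[of _ Ns]) simp
  qed
  then obtain Ns' where "covers m c T \<tau> Ns'"
    "card (N' - B) + cost_from N' Ns' \<le> card (N - B) + cost_from N Ns"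
    by blast
  with N' show ?thesis
    unfolding N'_def[symmetric] by (intro exI[of _ Ns']) simp
qed

section \<open>Optimal coverings that follow the policy\<close>

text \<open>
  This is KTNS without the bookkeeping of removed tools, and with an arbitrary initial content
  \<open>A\<close> of the magazine that may exceed the capacity.
\<close>

fun greedy :: "nat \<Rightarrow> nat \<Rightarrow> (nat \<Rightarrow> nat set) \<Rightarrow> nat set \<Rightarrow> nat list \<Rightarrow> nat set list \<Rightarrow> bool" where
  "greedy m c T A (j # \<sigma>) (M # Ms) \<longleftrightarrow>
     magazine_config m c M \<and> T j \<subseteq> M \<and> M \<subseteq> A \<union> T j \<and>
     (\<forall>t\<in>M. \<forall>u\<in>A - M. no_later T (j # \<sigma>) t u) \<and> greedy m c T M \<sigma> Ms"
| "greedy m c T A \<sigma> Ms \<longleftrightarrow> \<sigma> = [] \<and> Ms = []"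

text \<open>
  Here \<open>A\<close> and \<open>B\<close> are the contents from which the greedy configuration \<open>M\<close> and the first
  configuration \<open>N\<close> of the covering are reached. While \<open>M\<close> and \<open>N\<close> disagree on some tool that
  \<open>j # \<sigma>\<close> requires, one replacement in \<open>N\<close> reduces the disagreement.
\<close>

lemma follow_greedy_first:
  assumes greedy: "greedy m c T A (j # \<sigma>) (M # Ms)"
    and F: "F = \<Union> (T ` set (j # \<sigma>))"
    and agree: "B \<inter> F = A \<inter> F"
    and B: "B \<subseteq> {1..m}" "c \<le> card B"
    and cov: "covers m c T (j # \<sigma> @ \<rho>) (N # Ns)"
  shows "\<exists>N' Ns'. covers m c T (j # \<sigma> @ \<rho>) (N' # Ns') \<and> N' \<inter> F = M \<inter> F \<and>
    cost_from B (N' # Ns') \<le> cost_from B (N # Ns)"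
  using cov
proof (induction "card (sym_diff (N \<inter> F) (M \<inter> F))" arbitrary: N Ns rule: less_induct)
  case less
  have M: "magazine_config m c M" "T j \<subseteq> M" "M \<subseteq> A \<union> T j"
    and best: "\<And>t u. t \<in> M \<Longrightarrow> u \<in> A - M \<Longrightarrow> no_later T (j # \<sigma>) t u"
    using greedy by auto
  have N: "magazine_config m c N" "T j \<subseteq> N"
    using less.prems by auto
  have fin: "finite M" "finite N" "finite B"
    using magazine_config_finite M(1) N(1) B(1) finite_subset by blast+
  have cards: "card M = c" "card N = c"
    using M(1) N(1) by (auto simp: magazine_config_def)
  \<comment> \<open>Any admissible replacement that reduces the disagreement leads to the goal.\<close>
  have improve: ?case
    if "u \<in> N" "u \<notin> T j" "t \<in> B" "t \<notin> N" "u \<notin> B \<or> no_later T (\<sigma> @ \<rho>) t u"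
      and "t \<in> F \<longrightarrow> t \<in> M" "u \<in> F \<longrightarrow> u \<notin> M" "t \<in> F \<or> u \<in> F"
    for t u
  proof -
    have "t \<in> {1..m}" using that(3) B(1) by auto
    from replace_tool_in_first[OF less.prems that(1-4) this that(5)]
    obtain Ns1 where Ns1: "covers m c T (j # \<sigma> @ \<rho>) (insert t (N - {u}) # Ns1)"
      "cost_from B (insert t (N - {u}) # Ns1) \<le> cost_from B (N # Ns)"
      by blast
    define D where "D X = sym_diff (X \<inter> F) (M \<inter> F)" for X
    have "D (insert t (N - {u})) = D N - {t, u}"
      using that(1,4,6,7) by (auto simp: D_def)
    moreover have "D N \<inter> {t, u} \<noteq> {}"
      using that(1,4,6,7,8) by (auto simp: D_def)
    moreover have "finite (D N)"
      using fin by (simp add: D_def)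
    ultimately have "card (D (insert t (N - {u}))) < card (D N)"
      by (intro psubset_card_mono) auto
    then have "card (sym_diff (insert t (N - {u}) \<inter> F) (M \<inter> F)) <
        card (sym_diff (N \<inter> F) (M \<inter> F))"
      unfolding D_def .
    from less.hyps[OF this Ns1(1)] Ns1(2) show ?thesis
      by (meson order_trans)
  qed
  show ?case
  proof (cases "M \<inter> F \<subseteq> N")
    case False
    then obtain t where t: "t \<in> M" "t \<in> F" "t \<notin> N" by auto
    have "\<not> N \<subseteq> M"
      using card_subset_eq[OF fin(1), of N] cards t by auto
    then obtain u where u: "u \<in> N" "u \<notin> M" by auto
    have "t \<notin> T j" "u \<notin> T j" using t N(2) u M(2) by auto
    have "t \<in> B" using t M(3) \<open>t \<notin> T j\<close> agree by auto
    have "t \<in> \<Union> (T ` set \<sigma>)" using t(2) \<open>t \<notin> T j\<close> F by auto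
    have "u \<notin> B \<or> no_later T (\<sigma> @ \<rho>) t u"
    proof (cases "u \<in> F")
      case True
      have "no_later T (j # \<sigma>) t u" if "u \<in> B"
        using best[OF t(1)] True agree that u(2) by auto
      then show ?thesis
        using \<open>t \<notin> T j\<close> no_later_append[OF _ \<open>t \<in> \<Union> (T ` set \<sigma>)\<close>]
        unfolding no_later_Cons by blast
    next
      case False
      then have "no_later T \<sigma> t u" by (intro no_later_unused) (auto simp: F)
      from no_later_append[OF this \<open>t \<in> \<Union> (T ` set \<sigma>)\<close>] show ?thesis by simp
    qed
    then show ?thesis
      using t u by (intro improve[OF u(1) \<open>u \<notin> T j\<close> \<open>t \<in> B\<close> t(3)]) simp_all
  next
    case sub: True
    show ?thesis
    proof (cases "N \<inter> F \<subseteq> M")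
      case True
      with sub less.prems show ?thesis by (intro exI[of _ N] exI[of _ Ns]) auto
    next
      case False
      then obtain u where u: "u \<in> N" "u \<in> F" "u \<notin> M" by auto
      have "u \<notin> T j" using u M(2) by auto
      have "\<not> M \<subseteq> N"
        using card_subset_eq[OF fin(2), of M] cards u by auto
      then obtain s where s: "s \<in> M" "s \<notin> N" by auto
      with sub have "s \<notin> F" by auto
      \<comment> \<open>The policy kept \<open>s\<close>, which \<open>\<sigma>\<close> does not use again, so it dropped no tool of \<open>F\<close>.\<close>
      have kept: "v \<in> M" if "v \<in> B" "v \<in> F" for v
      proof (rule ccontr)
        assume "v \<notin> M"
        with that agree have "no_later T (j # \<sigma>) s v" by (intro best[OF s(1)]) auto
        from no_later_used[OF this] that(2) \<open>s \<notin> F\<close> show False by (auto simp: F)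
      qed
      then have "u \<notin> B" using u by auto
      have "\<not> B \<subseteq> N"
        using card_seteq[OF fin(2), of B] cards B(2) u(1) \<open>u \<notin> B\<close> by auto
      then obtain t where t: "t \<in> B" "t \<notin> N" by auto
      then have "t \<notin> F" using kept sub by auto
      with u show ?thesis
        using \<open>u \<notin> B\<close> by (intro improve[OF u(1) \<open>u \<notin> T j\<close> t]) simp_all
    qed
  qed
qed

lemma follow_greedy:
  assumes "greedy m c T A \<sigma> Ms"
    and "B \<inter> \<Union> (T ` set \<sigma>) = A \<inter> \<Union> (T ` set \<sigma>)"
    and "B \<subseteq> {1..m}" "c \<le> card B"
    and "covers m c T (\<sigma> @ \<rho>) Ns"
  shows "\<exists>Ns'. covers m c T (\<sigma> @ \<rho>) Ns' \<and> cost_from B Ns' \<le> cost_from B Ns \<and>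
    (\<forall>i<length \<sigma>. Ns' ! i \<inter> \<Union> (T ` set (drop i \<sigma>)) = Ms ! i \<inter> \<Union> (T ` set (drop i \<sigma>)))"
  using assms
proof (induction \<sigma> arbitrary: A B Ms Ns)
  case Nil
  then show ?case by auto
next
  case (Cons j \<sigma>)
  define F where "F = \<Union> (T ` set (j # \<sigma>))"
  obtain M Ms0 where Ms: "Ms = M # Ms0"
    using Cons.prems(1) by (cases Ms) auto
  have greedy: "greedy m c T A (j # \<sigma>) (M # Ms0)"
    using Cons.prems(1) Ms by simp
  obtain N Ns0 where Ns: "Ns = N # Ns0"
    using Cons.prems(5) by (auto elim: covers_ConsE)
  have agree: "B \<inter> F = A \<inter> F" using Cons.prems(2) by (simp add: F_def)
  have cov: "covers m c T (j # \<sigma> @ \<rho>) (N # Ns0)" using Cons.prems(5) Ns by simp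
  obtain N1 Ns1 where N1: "covers m c T (j # \<sigma> @ \<rho>) (N1 # Ns1)" "N1 \<inter> F = M \<inter> F"
    "cost_from B (N1 # Ns1) \<le> cost_from B (N # Ns0)"
    using follow_greedy_first[OF greedy F_def agree Cons.prems(3,4) cov] by blast
  have N1': "N1 \<subseteq> {1..m}" "c \<le> card N1" "covers m c T (\<sigma> @ \<rho>) Ns1"
    using N1(1) by (auto simp: magazine_config_def)
  have agree': "N1 \<inter> \<Union> (T ` set \<sigma>) = M \<inter> \<Union> (T ` set \<sigma>)"
    using N1(2) by (auto simp: F_def)
  have "greedy m c T M \<sigma> Ms0" using greedy by simp
  from Cons.IH[OF this agree' N1'] obtain Ns2 where Ns2: "covers m c T (\<sigma> @ \<rho>) Ns2"
    "cost_from N1 Ns2 \<le> cost_from N1 Ns1"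
    "\<forall>i<length \<sigma>. Ns2 ! i \<inter> \<Union> (T ` set (drop i \<sigma>)) = Ms0 ! i \<inter> \<Union> (T ` set (drop i \<sigma>))"
    by auto
  have "(N1 # Ns2) ! i \<inter> \<Union> (T ` set (drop i (j # \<sigma>))) = Ms ! i \<inter> \<Union> (T ` set (drop i (j # \<sigma>)))"
    if "i < length (j # \<sigma>)" for i
    using that Ns2(3) N1(2) by (cases i) (auto simp: Ms F_def)
  moreover have "covers m c T ((j # \<sigma>) @ \<rho>) (N1 # Ns2)"
    using N1(1) Ns2(1) by simp
  moreover have "cost_from B (N1 # Ns2) \<le> cost_from B Ns"
    using N1(3) Ns2(2) Ns by simp
  ultimately show ?case
    by (intro exI[of _ "N1 # Ns2"] conjI allI impI)
qed

lemma next_use_no_later: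
  assumes "next_use T \<sigma> i t \<le> next_use T \<sigma> i u"
  shows "no_later T (drop i \<sigma>) t u"
  unfolding no_later_def
proof (intro allI impI)
  fix k assume k: "k < length (drop i \<sigma>)" "u \<in> T (drop i \<sigma> ! k)"
  have "next_use T \<sigma> i u \<le> enat (i + k)"
    unfolding next_use_def using k by (intro INF_lower) (auto simp: add.commute)
  also have "enat (i + k) < enat (Suc (i + k))" by simp
  finally have "next_use T \<sigma> i t < enat (Suc (i + k))" using assms by simp
  then obtain l where l: "i \<le> l" "l < length \<sigma>" "t \<in> T (\<sigma> ! l)" "l \<le> i + k"
    unfolding next_use_def INF_less_iff by auto
  then show "\<exists>k'\<le>k. t \<in> T (drop i \<sigma> ! k')"
    by (intro exI[of _ "l - i"]) auto
qed

lemma ktns_greedy: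
  assumes ktns: "ktns m c T \<sigma> Ms" and cov: "covers m c T \<sigma> Ms"
  shows "greedy m c T {1..m} \<sigma> Ms"
proof -
  have len: "length Ms = length \<sigma>"
    using cov by (simp add: covers_def)
  have conf: "magazine_config m c (Ms ! i)" "T (\<sigma> ! i) \<subseteq> Ms ! i" if "i < length \<sigma>" for i
    using cov that by (auto simp: covers_def)
  define prev where "prev i = (if i = 0 then {1..m} else Ms ! (i - 1))" for i
  have choice: "Ms ! i \<subseteq> prev i \<union> T (\<sigma> ! i) \<and>
      (\<forall>t\<in>Ms ! i. \<forall>u\<in>prev i - Ms ! i. no_later T (drop i \<sigma>) t u)" if i: "i < length \<sigma>" for i
  proof (cases i)
    case 0
    have "\<sigma> \<noteq> []" using i by auto
    then have "\<forall>t\<in>Ms ! 0. \<forall>u\<in>{1..m} - Ms ! 0. next_use T \<sigma> 0 t \<le> next_use T \<sigma> 0 u"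
      using ktns by (simp add: ktns_def)
    then have "\<forall>t\<in>Ms ! 0. \<forall>u\<in>{1..m} - Ms ! 0. no_later T (drop 0 \<sigma>) t u"
      using next_use_no_later by blast
    moreover have "Ms ! 0 \<subseteq> {1..m}"
      using conf(1)[OF i] 0 by (simp add: magazine_config_def)
    ultimately show ?thesis using 0 by (auto simp: prev_def)
  next
    case (Suc k)
    have "Suc k < length \<sigma>" using i Suc by simp
    from ktns[unfolded ktns_def, THEN conjunct2, THEN conjunct2, THEN spec, THEN mp, OF this]
    obtain R where R: "R \<subseteq> Ms ! k - T (\<sigma> ! Suc k)"
      "\<forall>r\<in>R. \<forall>t\<in>(Ms ! k - T (\<sigma> ! Suc k)) - R. next_use T \<sigma> (Suc k) t \<le> next_use T \<sigma> (Suc k) r"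
      "Ms ! Suc k = (Ms ! k - R) \<union> (T (\<sigma> ! Suc k) - Ms ! k)"
      by (elim exE conjE)
    have "no_later T (drop (Suc k) \<sigma>) t u" if tu: "t \<in> Ms ! Suc k" "u \<in> Ms ! k - Ms ! Suc k" for t u
    proof (cases "t \<in> T (\<sigma> ! Suc k)")
      case True
      then show ?thesis
        using i Suc by (auto simp: no_later_Cons simp flip: Cons_nth_drop_Suc)
    next
      case False
      then have "t \<in> (Ms ! k - T (\<sigma> ! Suc k)) - R" "u \<in> R"
        using tu R(3) by auto
      then show ?thesis using R(2) next_use_no_later by blast
    qed
    then show ?thesis using R(3) Suc by (auto simp: prev_def)
  qed
  have "greedy m c T (prev i) (drop i \<sigma>) (drop i Ms)" if "i \<le> length \<sigma>" for i
    using that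
  proof (induction rule: inc_induct)
    case base
    show ?case using len by simp
  next
    case (step i)
    have "prev (Suc i) = Ms ! i" by (simp add: prev_def)
    moreover have "drop i \<sigma> = \<sigma> ! i # drop (Suc i) \<sigma>" "drop i Ms = Ms ! i # drop (Suc i) Ms"
      using step.hyps len by (simp_all add: Cons_nth_drop_Suc)
    ultimately show ?case
      using step.IH step.hyps conf[of i] choice[of i] by simp
  qed
  from this[of 0] show ?thesis by (simp add: prev_def)
qed

section \<open>Swapping two adjacent jobs\<close>

text \<open>
  In place of the first configuration \<open>P\<close>, the second one, \<open>Q\<close>, is loaded at once. This costs no
  more than reaching \<open>Q\<close> by way of \<open>P\<close>.
\<close>

lemma covering_of_swap:
  assumes cov: "covers m c T (\<alpha> @ [a, b] @ \<beta>) Ns"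
    and sub: "T a \<subseteq> Ns ! Suc (length \<alpha>)"
  shows "\<exists>Ns'. covers m c T (\<alpha> @ [b, a] @ \<beta>) Ns' \<and> cost_from A Ns' \<le> cost_from A Ns"
proof -
  define Xs where "Xs = take (length \<alpha>) Ns"
  have "length Ns = length \<alpha> + Suc (Suc (length \<beta>))"
    using cov by (simp add: covers_def)
  then have len: "length Xs = length \<alpha>" "length (drop (length \<alpha>) Ns) = Suc (Suc (length \<beta>))"
    by (auto simp: Xs_def)
  then obtain P Q Ys where "drop (length \<alpha>) Ns = P # Q # Ys"
    by (metis length_Suc_conv)
  then have Ns: "Ns = Xs @ [P, Q] @ Ys"
    unfolding Xs_def by (metis append_Cons append_Nil append_take_drop_id)
  have cov': "covers m c T \<alpha> Xs" "covers m c T ([a, b] @ \<beta>) ([P, Q] @ Ys)"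
    using cov covers_append[OF len(1)] unfolding Ns by blast+
  have "T a \<subseteq> Q"
    using sub len(1) by (simp add: Ns nth_append)
  with cov' have "covers m c T (\<alpha> @ [b, a] @ \<beta>) (Xs @ [Q, Q] @ Ys)"
    using covers_append[OF len(1)] by auto
  moreover
  have "cost_from (last (A # Xs)) [Q] \<le> card (P - last (A # Xs)) + cost_from P [Q]"
    using cov' by (intro cost_from_triangle[where \<tau> = "[b]" and T = T and m = m and c = c])
      (auto intro: magazine_config_finite)
  then have "cost_from A (Xs @ [Q, Q] @ Ys) \<le> cost_from A Ns"
    unfolding Ns by (simp add: cost_from_append)
  ultimately show ?thesis by blast
qed

lemma ex_covering:
  assumes "ssp_instance m n c T" and "set \<tau> \<subseteq> {1..n}"
  shows "\<exists>Ns. covers m c T \<tau> Ns"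
  using assms(2)
proof (induction \<tau>)
  case Nil
  show ?case by simp
next
  case (Cons j \<tau>)
  then obtain Ns where Ns: "covers m c T \<tau> Ns" by auto
  have "T j \<subseteq> {1..m}" "card (T j) \<le> c"
    using assms(1) Cons.prems unfolding ssp_instance_def by auto
  moreover have "c \<le> card {1..m}"
    using assms(1) unfolding ssp_instance_def by (metis card_atLeastAtMost diff_Suc_1 less_imp_le)
  ultimately obtain N where "T j \<subseteq> N" "N \<subseteq> {1..m}" "card N = c"
    using exists_subset_between[of "T j" c "{1..m}"] by auto
  with Ns have "covers m c T (j # \<tau>) (N # Ns)"
    by (simp add: magazine_config_def)
  then show ?case by blast
qed

lemma min_switches_attained:
  assumes "covers m c T \<tau> Ns"
  shows "\<exists>Ns'. covers m c T \<tau> Ns' \<and> switches Ns' = min_switches m c T \<tau>"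
proof -
  have "\<exists>k. \<exists>Ms. covers m c T \<tau> Ms \<and> k = switches Ms" using assms by blast
  from LeastI_ex[OF this] show ?thesis unfolding min_switches_def by metis
qed

lemma min_switches_le: "covers m c T \<tau> Ns \<Longrightarrow> min_switches m c T \<tau> \<le> switches Ns"
  unfolding min_switches_def by (rule Least_le) blast

lemma ex_completion:
  assumes "tree_node n \<sigma>"
  shows "\<exists>\<rho>. \<sigma> @ \<rho> \<in> completions n \<sigma>"
proof -
  have \<sigma>: "distinct \<sigma>" "set \<sigma> \<subseteq> {1..n}"
    using assms by (auto simp: tree_node_iff)
  obtain \<rho> where "set \<rho> = {1..n} - set \<sigma>" "distinct \<rho>"
    using finite_distinct_list[of "{1..n} - set \<sigma>"] by auto
  with \<sigma> have "\<sigma> @ \<rho> \<in> completions n \<sigma>"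
    by (auto simp: completions_def permutations_of_set_def)
  then show ?thesis by blast
qed

theorem proposition6:
  fixes m n c p :: nat and T :: "nat \<Rightarrow> nat set"
    and \<sigma> :: "nat list" and Ms :: "nat set list"
  assumes "ssp_instance m n c T"
    and "tree_node n \<sigma>"
    and "optimal_covering m c T \<sigma> Ms"
    and "ktns m c T \<sigma> Ms"
    and "p \<in> {1..<length \<sigma>}"
    and "T (\<sigma> ! (p - 1)) \<subseteq> Ms ! p"
    and "T (\<sigma> ! (p - 1)) \<subseteq> (\<Union>k\<in>{p..<length \<sigma>}. T (\<sigma> ! k))"
    and "\<sigma> ! (p - 1) > \<sigma> ! p"
  shows "dominated_by m n c T \<sigma>
    (take (p - 1) \<sigma> @ [\<sigma> ! p, \<sigma> ! (p - 1)] @ drop (p + 1) \<sigma>)"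
proof -
  define \<alpha> where "\<alpha> = take (p - 1) \<sigma>"
  define \<beta> where "\<beta> = drop (p + 1) \<sigma>"
  define a where "a = \<sigma> ! (p - 1)"
  define b where "b = \<sigma> ! p"
  define \<sigma>' where "\<sigma>' = \<alpha> @ [b, a] @ \<beta>"
  have p: "1 \<le> p" "p < length \<sigma>" using assms(5) by auto
  have "drop (p - 1) \<sigma> = a # b # \<beta>"
    using p Cons_nth_drop_Suc[of "p - 1" \<sigma>] Cons_nth_drop_Suc[of p \<sigma>]
    by (simp add: a_def b_def \<beta>_def)
  then have \<sigma>: "\<sigma> = \<alpha> @ [a, b] @ \<beta>"
    unfolding \<alpha>_def by (metis append_Cons append_Nil append_take_drop_id)
  have len: "Suc (length \<alpha>) = p" using p by (simp add: \<alpha>_def)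
  have node': "tree_node n \<sigma>'"
    using assms(2) unfolding \<sigma> \<sigma>'_def tree_node_iff by auto
  have greedy: "greedy m c T {1..m} \<sigma> Ms"
    using assms(3,4) by (intro ktns_greedy) (auto simp: optimal_covering_def)
  have Ta: "T a \<subseteq> \<Union> (T ` set (drop p \<sigma>))"
  proof
    fix t assume "t \<in> T a"
    then obtain k where k: "p \<le> k" "k < length \<sigma>" "t \<in> T (\<sigma> ! k)"
      using assms(7) unfolding a_def by force
    then have "drop p \<sigma> ! (k - p) \<in> set (drop p \<sigma>)" by (intro nth_mem) auto
    with k show "t \<in> \<Union> (T ` set (drop p \<sigma>))" by auto
  qed
  have swap: "min_switches m c T (\<sigma>' @ \<rho>) \<le> min_switches m c T (\<sigma> @ \<rho>)"
    if jobs: "set (\<sigma> @ \<rho>) \<subseteq> {1..n}" for \<rho>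
  proof -
    obtain Ns where Ns: "covers m c T (\<sigma> @ \<rho>) Ns" "switches Ns = min_switches m c T (\<sigma> @ \<rho>)"
      using ex_covering[OF assms(1) jobs] min_switches_attained by blast
    have "c \<le> card {1..m}"
      using assms(1) unfolding ssp_instance_def by (metis card_atLeastAtMost diff_Suc_1 less_imp_le)
    from follow_greedy[OF greedy refl order_refl this Ns(1)] p(2)
    obtain Ns1 where Ns1: "covers m c T (\<sigma> @ \<rho>) Ns1" "cost_from {1..m} Ns1 \<le> cost_from {1..m} Ns"
      "Ns1 ! p \<inter> \<Union> (T ` set (drop p \<sigma>)) = Ms ! p \<inter> \<Union> (T ` set (drop p \<sigma>))"
      by blast
    have "T a \<subseteq> Ns1 ! Suc (length \<alpha>)"
      using Ns1(3) Ta assms(6) len by (auto simp: a_def)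
    moreover have "covers m c T (\<alpha> @ [a, b] @ \<beta> @ \<rho>) Ns1"
      using Ns1(1) by (simp add: \<sigma>)
    ultimately obtain Ns2 where Ns2: "covers m c T (\<sigma>' @ \<rho>) Ns2"
      "cost_from {1..m} Ns2 \<le> cost_from {1..m} Ns1"
      using covering_of_swap[of m c T \<alpha> a b "\<beta> @ \<rho>" Ns1 "{1..m}"] by (auto simp: \<sigma>'_def)
    have "min_switches m c T (\<sigma>' @ \<rho>) \<le> switches Ns2"
      using Ns2(1) by (rule min_switches_le)
    also have "\<dots> \<le> switches Ns"
      using Ns1(2) Ns2(2) cost_from_all_tools[OF Ns(1)] cost_from_all_tools[OF Ns2(1)] by simp
    finally show ?thesis using Ns(2) by simp
  qed
  have "\<exists>k. \<exists>\<tau>\<in>completions n \<sigma>. k = min_switches m c T \<tau>"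
    using ex_completion[OF assms(2)] by blast
  from LeastI_ex[OF this] obtain \<tau> where \<tau>: "\<tau> \<in> completions n \<sigma>"
    "subproblem_value m n c T \<sigma> = min_switches m c T \<tau>"
    unfolding subproblem_value_def by blast
  then obtain \<rho> where \<rho>: "\<tau> = \<sigma> @ \<rho>" by (auto simp: completions_def prefix_def)
  have perm: "set (\<sigma> @ \<rho>) = {1..n}" "distinct (\<sigma> @ \<rho>)"
    using \<tau>(1) by (auto simp: \<rho> completions_def permutations_of_set_def)
  then have "set (\<sigma>' @ \<rho>) = {1..n}" "distinct (\<sigma>' @ \<rho>)"
    unfolding \<sigma> \<sigma>'_def by auto
  then have "\<sigma>' @ \<rho> \<in> completions n \<sigma>'"
    by (simp add: completions_def permutations_of_set_def)
  then have "subproblem_value m n c T \<sigma>' \<le> min_switches m c T (\<sigma>' @ \<rho>)"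
    unfolding subproblem_value_def by (intro Least_le) blast
  also have "\<dots> \<le> subproblem_value m n c T \<sigma>"
    using swap[OF equalityD1[OF perm(1)]] \<tau>(2) \<rho> by simp
  finally have "dominated_by m n c T \<sigma> \<sigma>'"
    using assms(2) node' by (simp add: dominated_by_def)
  then show ?thesis by (simp add: \<sigma>'_def \<alpha>_def \<beta>_def a_def b_def)
qed

end
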